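(* For every sufficiently small $\varepsilon>0$ and every sufficiently large $N$, there exists a label-invariant property $\mathcal P$ of distributions over $\{1,\ldots,N\}$ such that every $\varepsilon$-test for $\mathcal P$ in the conditional sampling model must draw $\Omega(\log N/\varepsilon)$ conditional samples.
   Context: Conditional sampling access to a distribution $\mu$ over $\Omega$: an oracle which, given $A\subseteq\Omega$, returns an element of $A$ distributed according to $\mu$ conditioned on $A$, independently of past calls. A property is a closed set $\mathcal P$ of distributions over $\Omega$; it is label-invariant if $\mu\in\mathcal P$ implies $\mu\circ\pi\in\mathcal P$ for every permutation $\pi$ of $\Omega$. An $\varepsilon$-test for $\mathcal P$ accepts with probability at least $2/3$ every input $\mu\in\mathcal P$ and rejects with probability at least $2/3$ every $\mu$ with $d_{\mathrm{TV}}(\mu,\mu')>\varepsilon$ for all $\mu'\in\mathcal P$, where $d_{\mathrm{TV}}(\mu,\mu')=\frac12\sum_x|\mu(x)-\mu'(x)|$. *)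

theory Defs
  imports "HOL-Probability.Probability"
begin

text \<open>
  Distributions over \<open>\<Omega>\<close> are probability mass functions supported in \<open>\<Omega>\<close>.
\<close>

definition dists :: "'a set \<Rightarrow> 'a pmf set" where
  "dists \<Omega> = {\<mu>. set_pmf \<mu> \<subseteq> \<Omega>}"

definition d_TV :: "'a set \<Rightarrow> 'a pmf \<Rightarrow> 'a pmf \<Rightarrow> real" where
  "d_TV \<Omega> \<mu> \<nu> = (\<Sum>x\<in>\<Omega>. \<bar>pmf \<mu> x - pmf \<nu> x\<bar>) / 2"

text \<open>
  Closedness is taken in the product topology on \<open>'a \<Rightarrow> real\<close>. For finite \<open>\<Omega>\<close> it induces on
  \<open>dists \<Omega>\<close> the Euclidean topology of the probability simplex, which is also the one given by
  total variation distance.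
\<close>

definition dist_property :: "'a set \<Rightarrow> 'a pmf set \<Rightarrow> bool" where
  "dist_property \<Omega> P \<longleftrightarrow> P \<subseteq> dists \<Omega> \<and> closed (pmf ` P)"

text \<open>
  The mass function of \<open>map_pmf (inv \<pi>) \<mu>\<close> is \<open>pmf \<mu> \<circ> \<pi>\<close>.
\<close>

definition label_invariant :: "'a set \<Rightarrow> 'a pmf set \<Rightarrow> bool" where
  "label_invariant \<Omega> P \<longleftrightarrow> (\<forall>\<mu>\<in>P. \<forall>\<pi>. \<pi> permutes \<Omega> \<longrightarrow> map_pmf (inv \<pi>) \<mu> \<in> P)"

text \<open>
  The conditional distribution is undefined when \<open>\<mu>(A) = 0\<close>; the oracle then answers \<open>None\<close>.
  An algorithm can simulate any other fixed convention for this case (for instance a uniformly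
  random element of \<open>A\<close>) from this one, so lower bounds carry over to those conventions.
\<close>

definition cond_oracle :: "'a pmf \<Rightarrow> 'a set \<Rightarrow> 'a option pmf" where
  "cond_oracle \<mu> A =
     (if measure_pmf.prob \<mu> A = 0 then return_pmf None else map_pmf Some (cond_pmf \<mu> A))"

text \<open>
  A deterministic adaptive strategy: \<open>Draw A f\<close> queries the oracle with \<open>A\<close> and continues with
  \<open>f r\<close> on answer \<open>r\<close>; \<open>Decide True\<close> accepts. A randomized algorithm is a probability
  distribution over deterministic strategies.
\<close>

datatype 'a strategy = Decide bool | Draw "'a set" "'a option \<Rightarrow> 'a strategy"

primrec verdict :: "'a pmf \<Rightarrow> 'a strategy \<Rightarrow> bool pmf" where
  "verdict \<mu> (Decide b) = return_pmf b"
| "verdict \<mu> (Draw A f) = bind_pmf (cond_oracle \<mu> A) (\<lambda>r. verdict \<mu> (f r))"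

definition outcome :: "'a pmf \<Rightarrow> 'a strategy pmf \<Rightarrow> bool pmf" where
  "outcome \<mu> T = bind_pmf T (verdict \<mu>)"

primrec queries_within :: "'a set \<Rightarrow> 'a strategy \<Rightarrow> bool" where
  "queries_within \<Omega> (Decide b) \<longleftrightarrow> True"
| "queries_within \<Omega> (Draw A f) \<longleftrightarrow>
     A \<subseteq> \<Omega> \<and> (\<forall>r\<in>insert None (Some ` A). queries_within \<Omega> (f r))"

primrec draws_at_most :: "'a strategy \<Rightarrow> nat \<Rightarrow> bool" where
  "draws_at_most (Decide b) q \<longleftrightarrow> True"
| "draws_at_most (Draw A f) q \<longleftrightarrow>
     0 < q \<and> (\<forall>r\<in>insert None (Some ` A). draws_at_most (f r) (q - 1))"

definition is_test :: "'a set \<Rightarrow> real \<Rightarrow> 'a pmf set \<Rightarrow> 'a strategy pmf \<Rightarrow> bool" where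
  "is_test \<Omega> \<epsilon> P T \<longleftrightarrow>
     (\<forall>t\<in>set_pmf T. queries_within \<Omega> t) \<and>
     (\<forall>\<mu>\<in>P. pmf (outcome \<mu> T) True \<ge> 2/3) \<and>
     (\<forall>\<mu>\<in>dists \<Omega>. (\<forall>\<mu>'\<in>P. d_TV \<Omega> \<mu> \<mu>' > \<epsilon>) \<longrightarrow> pmf (outcome \<mu> T) False \<ge> 2/3)"

definition sample_bound :: "'a strategy pmf \<Rightarrow> nat \<Rightarrow> bool" where
  "sample_bound T q \<longleftrightarrow> (\<forall>t\<in>set_pmf T. draws_at_most t q)"

end

(*
  The hard property encodes a binary code of length n = Omega(log N) in the histogram. The probability
  values live on n buckets, the i-th one being {2^i..<2^(i+1)} with total mass 1/n. A set X of buckets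
  is encoded by tilting the elements of the buckets in X by factors 1 + delta and 1 - delta according
  to parity, where delta is of order epsilon; bucket masses do not change. Probabilities in different
  buckets are well separated, so relabelling does not help and the distance of two encodings is at
  least of order delta times the relative Hamming distance. The property is the orbit of a linear code
  that is k-wise independent for some k = Omega(n) but far from most sets.

  For a fixed strategy, consider the acceptance probability as a function of X and the norm
  sum_S |f^(S)| l^|S| of its Fourier expansion. This norm is submultiplicative, and every draw increases
  it at most by the factor (1 + l delta) / (1 - l delta). The averages over the code and over all sets
  differ only in the Fourier coefficients of degree above k, hence by at most l^-(k+1) times the norm,
  so that telling them apart takes Omega(k / delta) draws.
*)

theory Submission
  imports Defs "HOL-Library.Discrete_Functions"
begin

subsection \<open>Fourier expansion on the cube\<close>

text \<open>Multiplying out the right-hand side chooses 1 or \<open>a j\<close> for each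
  \<open>j\<close>, and \<open>U\<close> records the choices. It serves three ends: orthogonality of
  characters, averages over the linear code, and a generating function for subset sizes.\<close>

lemma sum_prod_Pow:
  fixes a :: "'a \<Rightarrow> 'b::comm_semiring_1"
  assumes "finite J"
  shows "(\<Sum>U\<in>Pow J. \<Prod>j\<in>U. a j) = (\<Prod>j\<in>J. 1 + a j)"
  using assms
proof (induction J)
  case empty
  show ?case by simp
next
  case (insert x J)
  have disj: "Pow J \<inter> insert x ` Pow J = {}" and inj: "inj_on (insert x) (Pow J)"
    using insert.hyps by (auto simp: inj_on_def)
  have "(\<Sum>U\<in>insert x ` Pow J. prod a U) = (\<Sum>U\<in>Pow J. prod a (insert x U))"
    by (simp add: sum.reindex[OF inj])
  also have "\<dots> = (\<Sum>U\<in>Pow J. a x * prod a U)"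
    using insert.hyps by (intro sum.cong refl prod.insert) (auto dest: finite_subset)
  finally have "(\<Sum>U\<in>Pow (insert x J). prod a U) = (\<Sum>U\<in>Pow J. prod a U) + a x * (\<Sum>U\<in>Pow J. prod a U)"
    using insert.hyps disj by (simp add: Pow_insert sum.union_disjoint sum_distrib_left)
  then show ?case
    using insert by (simp add: algebra_simps)
qed

text \<open>The Walsh characters of the cube \<open>Pow I\<close>. Indices and points are both sets
  and can trade places. An infinite intersection has \<open>card\<close> 0 and gives the sign
  1.\<close>

definition chi :: "'a set \<Rightarrow> 'a set \<Rightarrow> real" where
  "chi S X = (-1) ^ card (S \<inter> X)"

lemma chi_empty [simp]: "chi {} X = 1" "chi S {} = 1"
  by (simp_all add: chi_def)

lemma chi_commute: "chi S X = chi X S"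
  by (simp add: chi_def Int_commute)

lemma abs_chi [simp]: "\<bar>chi S X\<bar> = 1"
  by (simp add: chi_def power_abs)

lemma chi_cases: "chi S X = 1 \<or> chi S X = -1"
  using abs_chi[of S X] by linarith

lemma chi_singleton: "chi {i} X = (if i \<in> X then -1 else 1)"
  by (simp add: chi_def)

lemma chi_eq_prod:
  assumes "finite S"
  shows "chi S X = (\<Prod>i\<in>S. if i \<in> X then -1 else 1)"
proof -
  have "S \<inter> {i. i \<in> X} = S \<inter> X"
    by auto
  then show ?thesis
    using assms by (simp add: prod.If_cases chi_def)
qed

text \<open>An element common to \<open>S\<close> and \<open>T\<close> contributes its sign twice,
  so it cancels.\<close>

lemma chi_mult_sym_diff:
  assumes "finite S" "finite T"
  shows "chi S X * chi T X = chi (sym_diff S T) X"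
proof -
  have split: "chi A X = chi (A - B) X * chi (A \<inter> B) X" if "finite A" for A B
    using prod.Int_Diff[OF that, of _ B] that by (simp add: chi_eq_prod mult.commute)
  have S: "chi S X = chi (S - T) X * chi (S \<inter> T) X"
    by (rule split[OF assms(1)])
  have T: "chi T X = chi (T - S) X * chi (S \<inter> T) X"
    using split[OF assms(2), of S] by (simp add: Int_commute)
  have sq: "chi (S \<inter> T) X * chi (S \<inter> T) X = 1"
    using chi_cases[of "S \<inter> T" X] by auto
  have "sym_diff S T - T = S - T" "sym_diff S T \<inter> T = T - S"
    by auto
  with split[of "sym_diff S T" T] have D: "chi (sym_diff S T) X = chi (S - T) X * chi (T - S) X"
    using assms by simp
  have "chi S X * chi T X = (chi (S - T) X * chi (T - S) X) * (chi (S \<inter> T) X * chi (S \<inter> T) X)"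
    unfolding S T by (simp only: mult_ac)
  then show ?thesis
    by (simp only: sq D mult_1_right)
qed

text \<open>Once the characters are read as products over \<open>X\<close>, the sum over all
  \<open>X\<close> splits into one factor per coordinate. A coordinate in exactly one of
  \<open>S\<close> and \<open>T\<close> has the factor 1 - 1.\<close>

lemma chi_orthogonal:
  assumes "finite I" "S \<subseteq> I" "T \<subseteq> I"
  shows "(\<Sum>X\<in>Pow I. chi S X * chi T X) = (if S = T then 2 ^ card I else 0)"
proof -
  let ?\<sigma> = "\<lambda>i A. if i \<in> A then -1 else 1 :: real"
  have "chi S X * chi T X = (\<Prod>i\<in>X. ?\<sigma> i S * ?\<sigma> i T)" if "X \<subseteq> I" for X
    using finite_subset[OF that assms(1)] chi_eq_prod[of X S] chi_eq_prod[of X T]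
    by (simp only: chi_commute[of S X] chi_commute[of T X] prod.distrib)
  then have "(\<Sum>X\<in>Pow I. chi S X * chi T X) = (\<Sum>X\<in>Pow I. \<Prod>i\<in>X. ?\<sigma> i S * ?\<sigma> i T)"
    by (intro sum.cong refl) blast
  also have "\<dots> = (\<Prod>i\<in>I. 1 + ?\<sigma> i S * ?\<sigma> i T)"
    by (rule sum_prod_Pow[OF assms(1)])
  also have "\<dots> = (if S = T then 2 ^ card I else 0)"
  proof (cases "S = T")
    case True
    then have "(\<Prod>i\<in>I. 1 + ?\<sigma> i S * ?\<sigma> i T) = (\<Prod>i\<in>I. 2)"
      by (intro prod.cong refl) simp
    with True show ?thesis
      by simp
  next
    case False
    then obtain i where "i \<in> I" "i \<in> S \<longleftrightarrow> i \<notin> T"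
      using assms by blast
    then have "\<exists>i\<in>I. 1 + ?\<sigma> i S * ?\<sigma> i T = 0"
      by (intro bexI[of _ i]) auto
    then have "(\<Prod>i\<in>I. 1 + ?\<sigma> i S * ?\<sigma> i T) = 0"
      by (rule prod_zero[OF assms(1)])
    with False show ?thesis
      by simp
  qed
  finally show ?thesis .
qed

section \<open>Fourier coefficients and the weighted spectral norm\<close>

definition fourier :: "'a set \<Rightarrow> ('a set \<Rightarrow> real) \<Rightarrow> 'a set \<Rightarrow> real" where
  "fourier I f S = (\<Sum>X\<in>Pow I. f X * chi S X) / 2 ^ card I"

definition wnorm :: "'a set \<Rightarrow> real \<Rightarrow> ('a set \<Rightarrow> real) \<Rightarrow> real" where
  "wnorm I l f = (\<Sum>S\<in>Pow I. \<bar>fourier I f S\<bar> * l ^ card S)"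

text \<open>Orthogonality with points and indices exchanged through \<open>chi_commute\<close>
  leaves only the term \<open>Y = X\<close>.\<close>

lemma fourier_inversion:
  assumes "finite I" "X \<subseteq> I"
  shows "f X = (\<Sum>S\<in>Pow I. fourier I f S * chi S X)"
proof -
  have "(\<Sum>S\<in>Pow I. fourier I f S * chi S X)
      = (\<Sum>S\<in>Pow I. \<Sum>Y\<in>Pow I. f Y * (chi Y S * chi X S)) / 2 ^ card I"
    by (simp add: fourier_def sum_distrib_right sum_divide_distrib chi_commute mult.assoc)
  also have "\<dots> = (\<Sum>Y\<in>Pow I. f Y * (\<Sum>S\<in>Pow I. chi Y S * chi X S)) / 2 ^ card I"
    by (subst sum.swap) (simp add: sum_distrib_left)
  also have "\<dots> = (\<Sum>Y\<in>Pow I. if Y = X then f Y * 2 ^ card I else 0) / 2 ^ card I"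
    using assms by (intro arg_cong2[where f = "(/)"] sum.cong refl) (simp add: chi_orthogonal)
  also have "\<dots> = f X"
    using assms by simp
  finally show ?thesis ..
qed

lemma wnorm_cong:
  assumes "\<And>X. X \<subseteq> I \<Longrightarrow> f X = g X"
  shows "wnorm I l f = wnorm I l g"
  unfolding wnorm_def fourier_def using assms by (intro sum.cong refl) simp

lemma wnorm_nonneg: "0 \<le> l \<Longrightarrow> 0 \<le> wnorm I l f"
  by (simp add: wnorm_def sum_nonneg)

lemma wnorm_sum:
  assumes "0 \<le> l"
  shows "wnorm I l (\<lambda>X. \<Sum>a\<in>A. f a X) \<le> (\<Sum>a\<in>A. wnorm I l (f a))"
proof -
  have "fourier I (\<lambda>X. \<Sum>a\<in>A. f a X) S = (\<Sum>a\<in>A. fourier I (f a) S)" for S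
    unfolding fourier_def sum_distrib_right by (subst sum.swap) (simp add: sum_divide_distrib)
  then have "wnorm I l (\<lambda>X. \<Sum>a\<in>A. f a X) \<le> (\<Sum>S\<in>Pow I. \<Sum>a\<in>A. \<bar>fourier I (f a) S\<bar> * l ^ card S)"
    unfolding wnorm_def sum_distrib_right[symmetric] using assms
    by (auto intro!: sum_mono mult_right_mono)
  also have "\<dots> = (\<Sum>a\<in>A. wnorm I l (f a))"
    unfolding wnorm_def by (rule sum.swap)
  finally show ?thesis .
qed

lemma wnorm_add:
  assumes "0 \<le> l"
  shows "wnorm I l (\<lambda>X. f X + g X) \<le> wnorm I l f + wnorm I l g"
  using wnorm_sum[OF assms, of I "\<lambda>b. if b then f else g" "UNIV :: bool set"]
  by (simp add: UNIV_bool add.commute)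

lemma wnorm_scale: "wnorm I l (\<lambda>X. c * f X) = \<bar>c\<bar> * wnorm I l f"
proof -
  have "fourier I (\<lambda>X. c * f X) S = c * fourier I f S" for S
    by (simp add: fourier_def sum_distrib_left mult.assoc)
  then show ?thesis
    by (simp add: wnorm_def sum_distrib_left abs_mult mult.assoc)
qed

lemma wnorm_chi:
  assumes "finite I" "S \<subseteq> I"
  shows "wnorm I l (chi S) = l ^ card S"
proof -
  have "wnorm I l (chi S) = (\<Sum>T\<in>Pow I. if T = S then l ^ card T else 0)"
    unfolding wnorm_def fourier_def using assms by (intro sum.cong refl) (auto simp: chi_orthogonal)
  then show ?thesis
    using assms by simp
qed

lemma wnorm_const:
  assumes "finite I"
  shows "wnorm I l (\<lambda>X. c) = \<bar>c\<bar>"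
  using wnorm_scale[of I l c "chi {}"] wnorm_chi[OF assms, of "{}" l] by simp

text \<open>Expand both factors. Two characters multiply to the character of the symmetric
  difference, whose size is at most \<open>card S + card T\<close>, so for \<open>l \<ge> 1\<close>
  its weight is at most the product of the two weights.\<close>

lemma wnorm_mult:
  assumes "finite I" "1 \<le> l"
  shows "wnorm I l (\<lambda>X. f X * g X) \<le> wnorm I l f * wnorm I l g"
proof -
  let ?F = "fourier I f" and ?G = "fourier I g"
  have l0: "0 \<le> l" using assms by simp
  have fin: "finite S" if "S \<subseteq> I" for S
    using that assms(1) finite_subset by blast
  have "wnorm I l (\<lambda>X. f X * g X)
      = wnorm I l (\<lambda>X. \<Sum>S\<in>Pow I. \<Sum>T\<in>Pow I. (?F S * ?G T) * chi (sym_diff S T) X)"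
  proof (rule wnorm_cong)
    fix X assume X: "X \<subseteq> I"
    have "f X * g X = (\<Sum>S\<in>Pow I. ?F S * chi S X) * (\<Sum>T\<in>Pow I. ?G T * chi T X)"
      using fourier_inversion[OF assms(1) X] by metis
    also have "\<dots> = (\<Sum>S\<in>Pow I. \<Sum>T\<in>Pow I. (?F S * ?G T) * (chi S X * chi T X))"
      by (simp add: sum_product mult_ac)
    also have "\<dots> = (\<Sum>S\<in>Pow I. \<Sum>T\<in>Pow I. (?F S * ?G T) * chi (sym_diff S T) X)"
      using fin by (intro sum.cong refl) (simp add: chi_mult_sym_diff)
    finally show "f X * g X = \<dots>" .
  qed
  also have "\<dots> \<le> (\<Sum>S\<in>Pow I. \<Sum>T\<in>Pow I. wnorm I l (\<lambda>X. (?F S * ?G T) * chi (sym_diff S T) X))"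
    by (rule order.trans[OF wnorm_sum[OF l0]]) (intro sum_mono wnorm_sum[OF l0])
  also have "\<dots> \<le> (\<Sum>S\<in>Pow I. \<Sum>T\<in>Pow I. (\<bar>?F S\<bar> * l ^ card S) * (\<bar>?G T\<bar> * l ^ card T))"
  proof (intro sum_mono)
    fix S T assume "S \<in> Pow I" "T \<in> Pow I"
    then have ST: "S \<subseteq> I" "T \<subseteq> I" by auto
    then have "card (sym_diff S T) \<le> card (S \<union> T)"
      using fin by (intro card_mono) auto
    then have "l ^ card (sym_diff S T) \<le> l ^ (card S + card T)"
      using assms(2) card_Un_le[of S T] by (intro power_increasing) auto
    moreover have "wnorm I l (chi (sym_diff S T)) = l ^ card (sym_diff S T)"
      using ST by (intro wnorm_chi assms(1)) auto
    ultimately have "wnorm I l (\<lambda>X. (?F S * ?G T) * chi (sym_diff S T) X)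
        \<le> \<bar>?F S * ?G T\<bar> * l ^ (card S + card T)"
      by (simp add: wnorm_scale mult_left_mono)
    then show "wnorm I l (\<lambda>X. (?F S * ?G T) * chi (sym_diff S T) X)
        \<le> (\<bar>?F S\<bar> * l ^ card S) * (\<bar>?G T\<bar> * l ^ card T)"
      by (simp add: abs_mult power_add mult_ac)
  qed
  also have "\<dots> = wnorm I l f * wnorm I l g"
    by (simp add: wnorm_def sum_product)
  finally show ?thesis .
qed

text \<open>
  Since \<open>g = 1 + h g\<close>, the finite number \<open>wnorm I l g\<close> is at most \<open>1 + B * wnorm I l g\<close>; no
  geometric series is needed.
\<close>

lemma wnorm_inverse:
  assumes "finite I" "1 \<le> l" "wnorm I l h \<le> B" "B < 1" "\<And>X. X \<subseteq> I \<Longrightarrow> h X \<noteq> 1"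
  shows "wnorm I l (\<lambda>X. 1 / (1 - h X)) \<le> 1 / (1 - B)"
proof -
  let ?g = "\<lambda>X. 1 / (1 - h X)"
  have "wnorm I l ?g = wnorm I l (\<lambda>X. 1 + h X * ?g X)"
    using assms(5) by (intro wnorm_cong) (auto simp: field_simps)
  also have "\<dots> \<le> wnorm I l (\<lambda>X. 1) + wnorm I l (\<lambda>X. h X * ?g X)"
    using assms(2) by (intro wnorm_add) simp
  also have "\<dots> \<le> 1 + wnorm I l h * wnorm I l ?g"
    using wnorm_mult[OF assms(1,2), of h ?g] by (simp add: wnorm_const[OF assms(1)])
  also have "\<dots> \<le> 1 + B * wnorm I l ?g"
    using assms(2,3) by (intro add_left_mono mult_right_mono wnorm_nonneg) auto
  finally show ?thesis
    using assms(4) by (simp add: field_simps)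
qed

text \<open>The indicator is \<open>(1 - chi {i} X) / 2\<close>, of norm
  \<open>(1 + l) / 2\<close>.\<close>

lemma wnorm_of_bool_mem:
  assumes "finite I" "1 \<le> l" "i \<in> I"
  shows "wnorm I l (\<lambda>X. of_bool (i \<in> X)) \<le> l"
proof -
  have "wnorm I l (\<lambda>X. of_bool (i \<in> X)) = wnorm I l (\<lambda>X. 1 / 2 + (-1 / 2) * chi {i} X)"
    by (intro wnorm_cong) (simp add: chi_singleton)
  also have "\<dots> \<le> wnorm I l (\<lambda>X. 1 / 2) + wnorm I l (\<lambda>X. (-1 / 2) * chi {i} X)"
    using assms by (intro wnorm_add) simp
  also have "\<dots> = 1 / 2 + 1 / 2 * l"
    unfolding wnorm_scale using assms by (simp add: wnorm_const wnorm_chi)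
  finally show ?thesis
    using assms by simp
qed

text \<open>
  The hypothesis on \<open>C\<close> is \<open>k\<close>-wise independence: averaging over \<open>C\<close> annihilates the nonconstant
  characters of degree at most \<open>k\<close>, and the remaining ones carry a factor \<open>l ^ (k + 1)\<close> in the norm.
\<close>

lemma average_diff_le_wnorm:
  fixes f :: "'a set \<Rightarrow> real" and C :: "'b \<Rightarrow> 'a set"
  assumes "finite I" "1 \<le> l" "finite A" "A \<noteq> {}" "\<And>U. U \<in> A \<Longrightarrow> C U \<subseteq> I"
    and indep: "\<And>S. S \<subseteq> I \<Longrightarrow> S \<noteq> {} \<Longrightarrow> card S \<le> k \<Longrightarrow> (\<Sum>U\<in>A. chi S (C U)) = 0"
  shows "\<bar>(\<Sum>U\<in>A. f (C U)) / card A - (\<Sum>X\<in>Pow I. f X) / 2 ^ card I\<bar> \<le> wnorm I l f / l ^ (k + 1)"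
proof -
  define a where "a S = (\<Sum>U\<in>A. chi S (C U)) / card A" for S
  have A: "real (card A) > 0"
    using assms by (simp add: card_gt_0_iff)
  have a0: "a {} = 1" and a_le: "\<bar>a S\<bar> \<le> 1" for S
    using A sum_abs[of "\<lambda>U. chi S (C U)" A] by (auto simp: a_def field_simps)
  have "(\<Sum>U\<in>A. f (C U)) = (\<Sum>U\<in>A. \<Sum>S\<in>Pow I. fourier I f S * chi S (C U))"
    using assms by (intro sum.cong refl fourier_inversion) auto
  also have "\<dots> = (\<Sum>S\<in>Pow I. fourier I f S * (\<Sum>U\<in>A. chi S (C U)))"
    by (subst sum.swap) (simp add: sum_distrib_left)
  finally have "(\<Sum>U\<in>A. f (C U)) / card A = (\<Sum>S\<in>Pow I. fourier I f S * a S)"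
    by (simp add: a_def sum_divide_distrib[of _ "Pow I"])
  also have "\<dots> = fourier I f {} + (\<Sum>S\<in>Pow I - {{}}. fourier I f S * a S)"
    using assms(1) by (subst sum.remove[of _ "{}"]) (auto simp: a0)
  finally have "\<bar>(\<Sum>U\<in>A. f (C U)) / card A - (\<Sum>X\<in>Pow I. f X) / 2 ^ card I\<bar>
      = \<bar>\<Sum>S\<in>Pow I - {{}}. fourier I f S * a S\<bar>"
    by (simp add: fourier_def)
  also have "\<dots> \<le> (\<Sum>S\<in>Pow I - {{}}. \<bar>fourier I f S\<bar> * l ^ card S / l ^ (k + 1))"
  proof (rule order.trans[OF sum_abs], rule sum_mono)
    fix S assume S: "S \<in> Pow I - {{}}"
    show "\<bar>fourier I f S * a S\<bar> \<le> \<bar>fourier I f S\<bar> * l ^ card S / l ^ (k + 1)"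
    proof (cases "card S \<le> k")
      case True
      then have "a S = 0"
        using S indep by (simp add: a_def)
      then show ?thesis
        using assms(2) by simp
    next
      case False
      then have "l ^ (k + 1) \<le> l ^ card S"
        using assms(2) by (intro power_increasing) auto
      then have "1 \<le> l ^ card S / l ^ (k + 1)"
        using assms(2) by (simp add: field_simps)
      then have "\<bar>a S\<bar> \<le> l ^ card S / l ^ (k + 1)"
        using a_le[of S] by linarith
      then show ?thesis
        by (metis abs_ge_zero abs_mult mult_left_mono times_divide_eq_right)
    qed
  qed
  also have "\<dots> \<le> (\<Sum>S\<in>Pow I. \<bar>fourier I f S\<bar> * l ^ card S / l ^ (k + 1))"
    using assms(1,2) by (intro sum_mono2) auto
  also have "\<dots> = wnorm I l f / l ^ (k + 1)"
    by (simp add: wnorm_def sum_divide_distrib)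
  finally show ?thesis .
qed

subsection \<open>Codes with large dual distance\<close>

text \<open>The Gilbert-Varshamov argument. The sets \<open>H j\<close> are the rows of a parity
  check matrix with columns indexed by \<open>I\<close>, in which no nonempty set of at most
  \<open>k\<close> columns sums to zero. Columns are added one by one, and the counting hypothesis
  always leaves a column that is not excluded.\<close>

lemma dual_distance_basis:
  fixes I :: "'a set" and J :: "'b set"
  assumes "finite I" "finite J" "card {T \<in> Pow I. card T \<le> k} < 2 ^ card J"
  shows "\<exists>H :: 'b \<Rightarrow> 'a set. \<forall>S\<subseteq>I. S \<noteq> {} \<longrightarrow> card S \<le> k \<longrightarrow> (\<exists>j\<in>J. chi S (H j) = -1)"
  using assms(1,3)
proof (induction I)
  case empty
  then show ?case by simp
next
  case (insert i I)
  have "card {T \<in> Pow I. card T \<le> k} \<le> card {T \<in> Pow (insert i I). card T \<le> k}"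
    using insert.hyps by (intro card_mono) auto
  with insert obtain H :: "'b \<Rightarrow> 'a set"
    where H: "\<And>S. S \<subseteq> I \<Longrightarrow> S \<noteq> {} \<Longrightarrow> card S \<le> k \<Longrightarrow> \<exists>j\<in>J. chi S (H j) = -1"
    by (metis (no_types, lifting) order.strict_trans1)
  \<comment> \<open>These are the column sums of the small sets \<open>T\<close>: a new column equal
    to one of them would cancel \<open>T\<close>. The choice \<open>T = {}\<close> excludes the zero
    column, which settles \<open>S = {i}\<close>.\<close>
  define bad where "bad = (\<lambda>T. {j\<in>J. chi T (H j) = -1}) ` {T \<in> Pow I. card T \<le> k}"
  have "card bad \<le> card {T \<in> Pow I. card T \<le> k}"
    using insert.hyps unfolding bad_def by (intro card_image_le) auto
  also have "\<dots> < card (Pow J)"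
    using \<open>card {T \<in> Pow I. card T \<le> k} \<le> _\<close> insert.prems assms(2) by (simp add: card_Pow)
  finally have "\<not> Pow J \<subseteq> bad"
    using insert.hyps card_mono[of bad "Pow J"] by (auto simp: bad_def)
  then obtain g where g: "g \<subseteq> J" "g \<notin> bad"
    by auto
  \<comment> \<open>The new column becomes exactly \<open>g\<close>. The induction hypothesis says
    nothing about \<open>i \<in> H j\<close>, so \<open>i\<close> is removed from the rows outside
    \<open>g\<close>.\<close>
  define H' where "H' j = (if j \<in> g then insert i (H j) else H j - {i})" for j
  have "\<exists>j\<in>J. chi S (H' j) = -1" if S: "S \<subseteq> insert i I" "S \<noteq> {}" "card S \<le> k" for S
  proof (cases "i \<in> S")
    case False
    then have "S \<inter> H' j = S \<inter> H j" for j
      by (auto simp: H'_def)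
    moreover have "S \<subseteq> I"
      using False S by auto
    ultimately show ?thesis
      using H[of S] S by (simp add: chi_def)
  next
    case True
    define T where "T = S - {i}"
    have fin: "finite S" "finite T"
      using S(1) insert.hyps finite_subset unfolding T_def by blast+
    have T: "T \<subseteq> I" "card T \<le> k" "S = insert i T" "i \<notin> T"
      using S True card_Diff1_le[of S i] by (auto simp: T_def)
    have "T \<inter> H' j = T \<inter> H j" for j
      using T by (auto simp: H'_def)
    then have "chi T (H' j) = chi T (H j)" for j
      by (simp add: chi_def)
    moreover have "chi S X = (if i \<in> X then -1 else 1) * chi T X" for X
      using fin T(3,4) by (simp add: chi_eq_prod)
    moreover have "i \<in> H' j \<longleftrightarrow> j \<in> g" for j
      by (simp add: H'_def)
    ultimately have eq: "chi S (H' j) = (if j \<in> g then -1 else 1) * chi T (H j)" for j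
      by simp
    have "g \<noteq> {j\<in>J. chi T (H j) = -1}"
      using g(2) T by (auto simp: bad_def)
    then obtain j where "j \<in> J" "j \<in> g \<longleftrightarrow> chi T (H j) \<noteq> -1"
      using g(1) by blast
    then show ?thesis
      using eq[of j] chi_cases[of T "H j"] by (intro bexI[of _ j]) auto
  qed
  then show ?case
    by blast
qed

text \<open>\<open>C U\<close> is the sum over the two-element field of the rows \<open>H j\<close>
  with \<open>j \<in> U\<close>, cut down to \<open>I\<close>, and \<open>p i U\<close> is the sign
  of its coordinate \<open>i\<close>. A character of \<open>C U\<close> is thus a product over
  \<open>U\<close>, its sum over all \<open>U\<close> is a product of factors
  \<open>1 + chi S (H j)\<close>, and one of these vanishes. Codewords are counted with
  multiplicity, as \<open>C\<close> need not be injective.\<close>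

lemma independent_code:
  fixes I :: "'a set" and J :: "'b set"
  assumes "finite I" "finite J" "card {T \<in> Pow I. card T \<le> k} < 2 ^ card J"
  obtains C :: "'b set \<Rightarrow> 'a set"
  where "\<And>U. C U \<subseteq> I"
    and "\<And>S. S \<subseteq> I \<Longrightarrow> S \<noteq> {} \<Longrightarrow> card S \<le> k \<Longrightarrow> (\<Sum>U\<in>Pow J. chi S (C U)) = 0"
proof -
  obtain H :: "'b \<Rightarrow> 'a set"
    where H: "\<And>S. S \<subseteq> I \<Longrightarrow> S \<noteq> {} \<Longrightarrow> card S \<le> k \<Longrightarrow> \<exists>j\<in>J. chi S (H j) = -1"
    using dual_distance_basis[OF assms] by blast
  define p where "p i U = (\<Prod>j\<in>U. if i \<in> H j then -1 else 1 :: real)" for i U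
  define C where "C U = {i\<in>I. p i U = -1}" for U
  have p: "p i U = 1 \<or> p i U = -1" for i U
  proof -
    have "\<bar>p i U\<bar> = (\<Prod>j\<in>U. 1)"
      unfolding p_def abs_prod by (intro prod.cong refl) simp
    then show ?thesis by (simp add: abs_if split: if_splits)
  qed
  have "(\<Sum>U\<in>Pow J. chi S (C U)) = 0" if S: "S \<subseteq> I" "S \<noteq> {}" "card S \<le> k" for S
  proof -
    have fin: "finite S"
      using S assms(1) finite_subset by blast
    have "chi S (C U) = (\<Prod>j\<in>U. chi S (H j))" for U
    proof -
      have "chi S (C U) = (\<Prod>i\<in>S. p i U)"
        unfolding chi_eq_prod[OF fin] using S(1) p[of _ U]
        by (intro prod.cong refl) (auto simp: C_def)
      also have "\<dots> = (\<Prod>j\<in>U. chi S (H j))"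
        unfolding chi_eq_prod[OF fin] p_def by (rule prod.swap)
      finally show ?thesis .
    qed
    then have "(\<Sum>U\<in>Pow J. chi S (C U)) = (\<Prod>j\<in>J. 1 + chi S (H j))"
      using sum_prod_Pow[OF assms(2), of "\<lambda>j. chi S (H j)"] by simp
    also have "\<dots> = 0"
      using H[OF S] by (intro prod_zero[OF assms(2)]) (metis add.right_inverse)
    finally show ?thesis .
  qed
  then show ?thesis
    by (intro that[of C]) (auto simp: C_def)
qed

text \<open>Give each \<open>T\<close> the weight 16 to the power \<open>- card T\<close>. Every
  counted set has weight at least 16 to the power \<open>-r\<close>, while all subsets together
  weigh \<open>(17 / 16) ^ (32 * r)\<close>, which is at most \<open>16 ^ r\<close>.\<close>

lemma card_small_subsets:
  assumes "finite I" "card I = 32 * r"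
  shows "card {T \<in> Pow I. card T \<le> r} \<le> 2 ^ (8 * r)"
proof -
  let ?B = "{T \<in> Pow I. card T \<le> r}"
  have "real (card ?B) * (1 / 16) ^ r = (\<Sum>T\<in>?B. (1 / 16) ^ r)"
    by simp
  also have "\<dots> \<le> (\<Sum>T\<in>?B. (1 / 16) ^ card T)"
    by (intro sum_mono power_decreasing) auto
  also have "\<dots> \<le> (\<Sum>T\<in>Pow I. (1 / 16) ^ card T)"
    using assms(1) by (intro sum_mono2) auto
  also have "\<dots> = (17 / 16) ^ (32 * r)"
    using sum_prod_Pow[OF assms(1), of "\<lambda>_. 1 / 16 :: real"] by (simp add: assms(2))
  also have "\<dots> = ((17 / 16) ^ 32) ^ r"
    by (rule power_mult)
  also have "\<dots> \<le> 16 ^ r"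
    by (intro power_mono) (simp_all add: power_divide)
  finally have "real (card ?B) \<le> 16 ^ r * 16 ^ r"
    by (simp add: power_divide field_simps)
  also have "\<dots> = real (2 ^ (8 * r))"
    by (simp add: power_mult flip: power_mult_distrib)
  finally show ?thesis
    by (simp only: of_nat_le_iff)
qed

lemma card_hamming_ball:
  assumes "finite I" "card I = 32 * r" "Y \<subseteq> I"
  shows "card {X \<in> Pow I. card (sym_diff X Y) \<le> r} \<le> 2 ^ (8 * r)"
proof -
  have "card {X \<in> Pow I. card (sym_diff X Y) \<le> r} \<le> card {T \<in> Pow I. card T \<le> r}"
    using assms by (intro card_inj_on_le[where f = "\<lambda>X. sym_diff X Y"]) (auto simp: inj_on_def)
  then show ?thesis
    using card_small_subsets[OF assms(1,2)] by linarith
qed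

text \<open>A union bound over \<open>2 ^ (16 * r)\<close> codewords. Among the
  \<open>2 ^ (32 * r)\<close> subsets of \<open>I\<close>, those near the code are therefore
  rare.\<close>

lemma card_near_code:
  assumes "finite I" "card I = 32 * r" "finite J" "card J = 16 * r" "\<And>U. C U \<subseteq> I"
  shows "card {X \<in> Pow I. \<exists>U\<in>Pow J. card (sym_diff X (C U)) \<le> r} \<le> 2 ^ (24 * r)"
proof -
  have "card {X \<in> Pow I. \<exists>U\<in>Pow J. card (sym_diff X (C U)) \<le> r}
      = card (\<Union>U\<in>Pow J. {X \<in> Pow I. card (sym_diff X (C U)) \<le> r})"
    by (intro arg_cong[where f = card]) auto
  also have "\<dots> \<le> (\<Sum>U\<in>Pow J. card {X \<in> Pow I. card (sym_diff X (C U)) \<le> r})"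
    using assms by (intro card_UN_le) auto
  also have "\<dots> \<le> (\<Sum>U\<in>Pow J. 2 ^ (8 * r))"
    using assms by (intro sum_mono card_hamming_ball) auto
  also have "\<dots> = 2 ^ (24 * r)"
    using assms by (simp add: card_Pow flip: power_add)
  finally show ?thesis .
qed

subsection \<open>Strategies\<close>

lemma pmf_verdict_Draw:
  assumes "finite A" "measure_pmf.prob \<mu> A \<noteq> 0"
  shows "pmf (verdict \<mu> (Draw A f)) a
    = (\<Sum>v\<in>A. pmf \<mu> v / measure_pmf.prob \<mu> A * pmf (verdict \<mu> (f (Some v))) a)"
proof -
  have ne: "set_pmf \<mu> \<inter> A \<noteq> {}"
    using assms(2) by (simp add: measure_pmf_zero_iff)
  have "pmf (verdict \<mu> (Draw A f)) a = pmf (bind_pmf (cond_pmf \<mu> A) (\<lambda>v. verdict \<mu> (f (Some v)))) a"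
    using assms(2) by (simp add: cond_oracle_def bind_map_pmf)
  also have "\<dots> = (\<Sum>v\<in>A. pmf (cond_pmf \<mu> A) v *\<^sub>R pmf (verdict \<mu> (f (Some v))) a)"
    unfolding pmf_bind using ne by (intro integral_measure_pmf assms(1)) auto
  finally show ?thesis
    using ne by (simp add: pmf_cond)
qed

text \<open>The probability of the answer \<open>v\<close> factors as \<open>m v X * g X\<close>,
  where \<open>m v\<close> is the numerator and \<open>g\<close> the inverse mass of the queried
  set, both normalized by \<open>W\<close>. The norms of the \<open>m v\<close> add up to at most
  \<open>1 + l * \<delta>\<close> and that of \<open>g\<close> is at most
  \<open>1 / (1 - l * \<delta>)\<close>, so submultiplicativity charges one factor per draw.\<close>

lemma wnorm_verdict_le:
  fixes \<mu> :: "'i set \<Rightarrow> 'a pmf" and s w :: "'a \<Rightarrow> real"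
  assumes I: "finite I" and \<Omega>: "finite \<Omega>"
    and \<mu>: "\<And>X v. X \<subseteq> I \<Longrightarrow> pmf (\<mu> X) v = w v * (1 + \<delta> * s v * of_bool (b v \<in> X))"
    and w: "\<And>v. 0 \<le> w v" and s: "\<And>v. \<bar>s v\<bar> \<le> 1" and b: "\<And>v. w v \<noteq> 0 \<Longrightarrow> b v \<in> I"
    and \<delta>: "0 \<le> \<delta>" and l: "1 \<le> l" and l\<delta>: "l * \<delta> < 1"
    and "queries_within \<Omega> t" "draws_at_most t q"
  shows "wnorm I l (\<lambda>X. pmf (verdict (\<mu> X) t) a) \<le> ((1 + l * \<delta>) / (1 - l * \<delta>)) ^ q"
  using assms(10,11)
proof (induction t arbitrary: q)
  case (Decide c)
  have "1 \<le> (1 + l * \<delta>) / (1 - l * \<delta>)"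
    using \<delta> l l\<delta> by simp
  then have "1 \<le> ((1 + l * \<delta>) / (1 - l * \<delta>)) ^ q"
    by (rule one_le_power)
  then show ?case
    using pmf_le_1[of "return_pmf c" a] by (simp add: wnorm_const[OF I] del: pmf_return)
next
  case (Draw A f)
  define B where "B = (1 + l * \<delta>) / (1 - l * \<delta>)"
  have B1: "1 \<le> B"
    using \<delta> l l\<delta> by (simp add: B_def)
  obtain p where p: "q = Suc p"
    using Draw.prems(2) by (cases q) auto
  have IH: "wnorm I l (\<lambda>X. pmf (verdict (\<mu> X) (f r)) a) \<le> B ^ p" if "r \<in> insert None (Some ` A)" for r
    unfolding B_def using Draw.prems that p by (intro Draw.IH) auto
  have A: "finite A"
    using Draw.prems(1) \<Omega> finite_subset by auto
  \<comment> \<open>\<open>W\<close> is the mass of \<open>A\<close> without tilt, and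
    \<open>h X\<close> the relative loss of mass caused by the tilt. Its sign is chosen so that the
    mass becomes \<open>W * (1 - h X)\<close>, as \<open>wnorm_inverse\<close> requires.\<close>
  define W where "W = (\<Sum>v\<in>A. w v)"
  define h where "h X = (\<Sum>v\<in>A. (w v / W * (- \<delta> * s v)) * of_bool (b v \<in> X))" for X
  have prob: "measure_pmf.prob (\<mu> X) A = (\<Sum>v\<in>A. w v * (1 + \<delta> * s v * of_bool (b v \<in> X)))"
    if "X \<subseteq> I" for X
    using A \<mu>[OF that] by (simp add: measure_measure_pmf_finite)
  show ?case
  proof (cases "W = 0")
    \<comment> \<open>Here \<open>A\<close> has mass 0 under every \<open>\<mu> X\<close>. The
      answer is always \<open>None\<close>, and the draw costs no factor.\<close>
    case True
    then have "\<forall>v\<in>A. w v = 0"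
      using A w by (simp add: W_def sum_nonneg_eq_0_iff)
    then have "wnorm I l (\<lambda>X. pmf (verdict (\<mu> X) (Draw A f)) a)
        = wnorm I l (\<lambda>X. pmf (verdict (\<mu> X) (f None)) a)"
      by (intro wnorm_cong) (simp add: prob cond_oracle_def bind_return_pmf)
    also have "\<dots> \<le> B ^ p"
      by (rule IH) simp
    also have "\<dots> \<le> B ^ q"
      using B1 p by (intro power_increasing) auto
    finally show ?thesis
      by (simp add: B_def)
  next
    case False
    then have W: "0 < W"
      using w sum_nonneg[of A w] by (auto simp: W_def order.strict_iff_order)
    have prob_W: "measure_pmf.prob (\<mu> X) A = W * (1 - h X)" if "X \<subseteq> I" for X
    proof -
      have "W * h X = (\<Sum>v\<in>A. - (w v * (\<delta> * s v * of_bool (b v \<in> X))))"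
        unfolding h_def sum_distrib_left using W by (intro sum.cong refl) simp
      then have "W * (1 - h X) = (\<Sum>v\<in>A. w v) + (\<Sum>v\<in>A. w v * (\<delta> * s v * of_bool (b v \<in> X)))"
        by (simp only: right_diff_distrib sum_negf W_def mult_1_right diff_minus_eq_add)
      also have "\<dots> = (\<Sum>v\<in>A. w v * (1 + \<delta> * s v * of_bool (b v \<in> X)))"
        by (simp only: distrib_left sum.distrib mult_1_right)
      finally show ?thesis
        using prob[OF that] by simp
    qed
    have sum1: "(\<Sum>v\<in>A. w v / W) = 1"
      using W by (simp add: W_def flip: sum_divide_distrib)
    have \<delta>1: "\<delta> \<le> l * \<delta>"
      using mult_right_mono[OF l \<delta>] by simp
    \<comment> \<open>This pointwise bound keeps the mass of \<open>A\<close> positive; the norm of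
      \<open>h\<close> is bounded separately below.\<close>
    have h_le: "h X \<le> \<delta>" for X
    proof -
      have "h X \<le> (\<Sum>v\<in>A. w v / W * \<delta>)"
        unfolding h_def
      proof (rule sum_mono)
        fix v
        have "\<bar>(- \<delta> * s v) * of_bool (b v \<in> X)\<bar> \<le> \<delta> * 1"
          unfolding abs_mult using s[of v] \<delta> by (auto simp: abs_mult mult_left_le)
        then have "(- \<delta> * s v) * of_bool (b v \<in> X) \<le> \<delta>"
          by linarith
        then show "w v / W * (- \<delta> * s v) * of_bool (b v \<in> X) \<le> w v / W * \<delta>"
          using w[of v] W unfolding mult.assoc[of "w v / W"]
            by (intro mult_left_mono) auto
      qed
      also have "\<dots> = \<delta>"
        by (simp only: sum_distrib_right[symmetric] sum1 mult_1_left)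
      finally show ?thesis .
    qed
    have h_norm: "wnorm I l h \<le> l * \<delta>"
    proof -
      have "wnorm I l h \<le> (\<Sum>v\<in>A. wnorm I l (\<lambda>X. (w v / W * (- \<delta> * s v)) * of_bool (b v \<in> X)))"
        unfolding h_def using l by (intro wnorm_sum) simp
      also have "\<dots> \<le> (\<Sum>v\<in>A. w v / W * (l * \<delta>))"
      proof (rule sum_mono)
        fix v
        show "wnorm I l (\<lambda>X. (w v / W * (- \<delta> * s v)) * of_bool (b v \<in> X)) \<le> w v / W * (l * \<delta>)"
        \<comment> \<open>\<open>b v \<in> I\<close> is known only for points of nonzero weight; any
          other point contributes the zero function.\<close>
        proof (cases "w v = 0")
          case True
          then show ?thesis by (simp add: wnorm_const[OF I])
        next
          case False
          have "\<bar>- \<delta> * s v\<bar> \<le> \<delta>"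
            using s[of v] \<delta> by (simp add: abs_mult mult_left_le)
          then have "\<bar>w v / W\<bar> * \<bar>- \<delta> * s v\<bar> \<le> w v / W * \<delta>"
            using w[of v] W by (intro mult_mono) auto
          then have "\<bar>w v / W * (- \<delta> * s v)\<bar> \<le> w v / W * \<delta>"
            by (simp only: abs_mult)
          then have "\<bar>w v / W * (- \<delta> * s v)\<bar> * wnorm I l (\<lambda>X. of_bool (b v \<in> X)) \<le> (w v / W * \<delta>) * l"
            using False b w[of v] W \<delta> l
            by (intro mult_mono wnorm_of_bool_mem I wnorm_nonneg) auto
          then show ?thesis
            unfolding wnorm_scale by (simp only: mult_ac)
        qed
      qed
      also have "\<dots> = l * \<delta>"
        by (simp only: sum_distrib_right[symmetric] sum1 mult_1_left)
      finally show ?thesis .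
    qed
    have h_ne: "1 - h X > 0" for X
      using h_le[of X] \<delta>1 l\<delta> by linarith
    define g where "g X = 1 / (1 - h X)" for X
    have g_norm: "wnorm I l g \<le> 1 / (1 - l * \<delta>)"
      unfolding g_def using h_ne by (intro wnorm_inverse I l h_norm l\<delta>) (auto simp: less_le)
    define m where "m v X = w v / W * (1 + \<delta> * s v * of_bool (b v \<in> X))" for v X
    have m_norm: "wnorm I l (m v) \<le> w v / W * (1 + l * \<delta>)" for v
    proof (cases "w v = 0")
      case True
      then show ?thesis
        unfolding m_def by (simp add: wnorm_const[OF I])
    next
      case False
      have "\<bar>\<delta> * s v\<bar> * wnorm I l (\<lambda>X. of_bool (b v \<in> X)) \<le> \<delta> * l"
        using False b s[of v] \<delta> l
        by (intro mult_mono wnorm_of_bool_mem I wnorm_nonneg) (auto simp: abs_mult mult_left_le)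
      then have "wnorm I l (\<lambda>X. 1 + \<delta> * s v * of_bool (b v \<in> X)) \<le> 1 + l * \<delta>"
        using l wnorm_add[of l I "\<lambda>X. 1" "\<lambda>X. \<delta> * s v * of_bool (b v \<in> X)"]
        unfolding wnorm_const[OF I] wnorm_scale by (simp add: mult.commute)
      then show ?thesis
        unfolding m_def wnorm_scale using w[of v] W by (intro mult_mono wnorm_nonneg) (use l in auto)
    qed
    have "wnorm I l (\<lambda>X. pmf (verdict (\<mu> X) (Draw A f)) a)
        = wnorm I l (\<lambda>X. \<Sum>v\<in>A. (m v X * g X) * pmf (verdict (\<mu> X) (f (Some v))) a)"
    proof (rule wnorm_cong)
      fix X assume X: "X \<subseteq> I"
      have "measure_pmf.prob (\<mu> X) A \<noteq> 0"
        using prob_W[OF X] W h_ne[of X] by simp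
      from pmf_verdict_Draw[OF A this]
      show "pmf (verdict (\<mu> X) (Draw A f)) a
          = (\<Sum>v\<in>A. (m v X * g X) * pmf (verdict (\<mu> X) (f (Some v))) a)"
        unfolding prob_W[OF X] \<mu>[OF X] by (simp add: m_def g_def)
    qed
    also have "\<dots> \<le> (\<Sum>v\<in>A. wnorm I l (\<lambda>X. (m v X * g X) * pmf (verdict (\<mu> X) (f (Some v))) a))"
      using l by (intro wnorm_sum) simp
    also have "\<dots> \<le> (\<Sum>v\<in>A. (w v / W * (1 + l * \<delta>) * (1 / (1 - l * \<delta>))) * B ^ p)"
    proof (rule sum_mono)
      fix v assume v: "v \<in> A"
      have w0: "0 \<le> w v / W" "0 \<le> 1 + l * \<delta>"
        using w[of v] W \<delta> l by simp_all
      have "wnorm I l (\<lambda>X. (m v X * g X) * pmf (verdict (\<mu> X) (f (Some v))) a)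
          \<le> wnorm I l (\<lambda>X. m v X * g X) * wnorm I l (\<lambda>X. pmf (verdict (\<mu> X) (f (Some v))) a)"
        by (rule wnorm_mult[OF I l])
      also have "\<dots> \<le> (wnorm I l (m v) * wnorm I l g) * wnorm I l (\<lambda>X. pmf (verdict (\<mu> X) (f (Some v))) a)"
        using l by (intro mult_right_mono wnorm_mult I wnorm_nonneg) auto
      also have "\<dots> \<le> (w v / W * (1 + l * \<delta>) * (1 / (1 - l * \<delta>))) * B ^ p"
        using v l w0 l\<delta> by (intro mult_mono m_norm g_norm IH wnorm_nonneg mult_nonneg_nonneg) auto
      finally show "wnorm I l (\<lambda>X. (m v X * g X) * pmf (verdict (\<mu> X) (f (Some v))) a)
          \<le> (w v / W * (1 + l * \<delta>) * (1 / (1 - l * \<delta>))) * B ^ p" .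
    qed
    also have "\<dots> = (\<Sum>v\<in>A. w v / W) * (B * B ^ p)"
      unfolding sum_distrib_right by (intro sum.cong refl) (simp add: B_def)
    also have "\<dots> = B ^ q"
      by (simp add: sum1 p)
    finally show ?thesis
      by (simp add: B_def)
  qed
qed

subsection \<open>Encoding codewords as distributions\<close>

lemma sum_buckets:
  "(\<Sum>v\<in>{2..<2 ^ (n + 1)}. h v) = (\<Sum>i=1..n. \<Sum>v\<in>{2 ^ i..<2 ^ (i + 1)}. h v)"
  for h :: "nat \<Rightarrow> real"
proof (induction n)
  case (Suc n)
  have "(2::nat) ^ 1 \<le> 2 ^ (n + 1)"
    by (rule power_increasing) auto
  then have "(\<Sum>v\<in>{2..<2 ^ (n + 1)}. h v) + (\<Sum>v\<in>{2 ^ (n + 1)..<2 ^ (Suc n + 1)}. h v)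
      = (\<Sum>v\<in>{2..<2 ^ (Suc n + 1)}. h v)"
    by (intro sum.atLeastLessThan_concat) auto
  with Suc show ?case
    by simp
qed simp

lemma sum_alternating_even:
  "(\<Sum>v\<in>{2 * a..<2 * a + 2 * m}. (-1) ^ v) = (0::real)"
  by (induction m) simp_all

lemma floor_log_bucket:
  assumes "v \<in> {2 ^ i..<2 ^ (i + 1)}"
  shows "floor_log v = i"
  using assms by (intro floor_log_eqI) (auto intro: order.strict_trans2)

text \<open>The points with \<open>floor_log v = i\<close> share the mass \<open>1 / n\<close>
  equally, so weights in different buckets differ by a factor of at least 2. Bucket 0 is left out:
  it is the single point 1, in which no parities can balance.\<close>

definition bucket_weight :: "nat \<Rightarrow> nat \<Rightarrow> real" where
  "bucket_weight n v = (if v \<in> {2..<2 ^ (n + 1)} then 1 / (n * 2 ^ floor_log v) else 0)"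

definition bucket_pmf :: "nat \<Rightarrow> real \<Rightarrow> nat set \<Rightarrow> nat pmf" where
  "bucket_pmf n \<delta> X =
     embed_pmf (\<lambda>v. bucket_weight n v * (1 + \<delta> * (-1) ^ v * of_bool (floor_log v \<in> X)))"

lemma bucket_weight_nonneg: "0 \<le> bucket_weight n v"
  by (simp add: bucket_weight_def)

lemma floor_log_in_range:
  assumes "v \<in> {2..<2 ^ (n + 1)}"
  shows "floor_log v \<in> {1..n}"
proof -
  have "2 ^ floor_log v \<le> v"
    using assms by (intro floor_log_exp2_le) auto
  then have "(2::nat) ^ floor_log v < 2 ^ (n + 1)"
    using assms by auto
  moreover have "floor_log 2 \<le> floor_log v"
    using assms by (intro floor_log_le_iff) auto
  ultimately show ?thesis
    using floor_log_twice[of 1] power_less_imp_less_exp[of "2::nat" "floor_log v" "n + 1"] by simp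
qed

lemma sum_bucket_weight:
  fixes h :: "nat \<Rightarrow> real"
  shows
  "(\<Sum>v\<in>{2..<2 ^ (n + 1)}. bucket_weight n v * h v)
    = (\<Sum>i=1..n. (\<Sum>v\<in>{2 ^ i..<2 ^ (i + 1)}. h v) / (n * 2 ^ i))"
  unfolding sum_buckets sum_divide_distrib
proof (intro sum.cong refl)
  fix i v :: nat assume i: "i \<in> {1..n}" and v: "v \<in> {2 ^ i..<2 ^ (i + 1)}"
  have "(2::nat) ^ 1 \<le> 2 ^ i" "(2::nat) ^ (i + 1) \<le> 2 ^ (n + 1)"
    using i by (intro power_increasing; simp)+
  moreover have "2 ^ i \<le> v" "v < 2 ^ (i + 1)"
    using v by auto
  ultimately have "v \<in> {2..<2 ^ (n + 1)}"
    unfolding atLeastLessThan_iff power_one_right by (blast intro: order.trans order.strict_trans2)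
  then show "bucket_weight n v * h v = h v / (n * 2 ^ i)"
    using floor_log_bucket[OF v] by (simp add: bucket_weight_def)
qed

lemma sum_bucket_weight_indicator:
  assumes "0 < n" "D \<subseteq> {1..n}"
  shows "(\<Sum>v\<in>{2..<2 ^ (n + 1)}. bucket_weight n v * of_bool (floor_log v \<in> D)) = card D / n"
proof -
  have "(\<Sum>v\<in>{2 ^ i..<2 ^ (i + 1)}. of_bool (floor_log v \<in> D)) = of_bool (i \<in> D) * (2 ^ i :: real)" for i
  proof -
    have "(\<Sum>v\<in>{2 ^ i..<2 ^ (i + 1)}. of_bool (floor_log v \<in> D))
        = (\<Sum>v\<in>{2 ^ i..<2 ^ (i + 1) :: nat}. of_bool (i \<in> D) :: real)"
      using floor_log_bucket by (intro sum.cong refl) auto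
    then show ?thesis by simp
  qed
  then have "(\<Sum>v\<in>{2..<2 ^ (n + 1)}. bucket_weight n v * of_bool (floor_log v \<in> D))
      = (\<Sum>i=1..n. of_bool (i \<in> D) / n)"
    unfolding sum_bucket_weight by simp
  also have "\<dots> = card ({1..n} \<inter> D) / n"
    by (simp add: sum.If_cases of_bool_def Int_def flip: sum_divide_distrib)
  finally show ?thesis
    using assms(2) by (simp add: Int_absorb1)
qed

text \<open>
  Every bucket contains as many even as odd elements, so its mass does not depend on \<open>X\<close>.
\<close>

lemma pmf_bucket_pmf:
  assumes "0 < n" "0 \<le> \<delta>" "\<delta> \<le> 1"
  shows "pmf (bucket_pmf n \<delta> X) v
    = bucket_weight n v * (1 + \<delta> * (-1) ^ v * of_bool (floor_log v \<in> X))"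
  unfolding bucket_pmf_def
proof (rule pmf_embed_pmf)
  let ?f = "\<lambda>v. bucket_weight n v * (1 + \<delta> * (-1) ^ v * of_bool (floor_log v \<in> X))"
  let ?V = "{2..<2 ^ (n + 1)} :: nat set"
  have "0 \<le> 1 + \<delta> * (-1) ^ v * of_bool (floor_log v \<in> X)" for v
    using assms by (cases "even v") auto
  then show nonneg: "0 \<le> ?f v" for v
    using bucket_weight_nonneg[of n v] by (intro mult_nonneg_nonneg)
  have "(\<Sum>v\<in>{2 ^ i..<2 ^ (i + 1)}. (-1) ^ v * of_bool (floor_log v \<in> X)) = (0::real)"
    if i: "i \<in> {1..n}" for i
  proof -
    have "(\<Sum>v\<in>{2 ^ i..<2 ^ (i + 1)}. (-1) ^ v * of_bool (floor_log v \<in> X))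
        = (\<Sum>v\<in>{2 ^ i..<2 ^ (i + 1) :: nat}. (-1) ^ v) * (of_bool (i \<in> X) :: real)"
      unfolding sum_distrib_right using floor_log_bucket by (intro sum.cong refl) auto
    \<comment> \<open>From \<open>i \<ge> 1\<close> the bucket starts at an even number and has even
      length, so the signs cancel.\<close>
    moreover obtain j where "i = Suc j"
      using i by (cases i) auto
    then have "{2 ^ i..<2 ^ (i + 1)} = {2 * 2 ^ j..<2 * 2 ^ j + 2 * 2 ^ j :: nat}"
      by simp
    ultimately show ?thesis
      by (simp only: sum_alternating_even mult_zero_left)
  qed
  then have zero: "(\<Sum>v\<in>?V. bucket_weight n v * ((-1) ^ v * of_bool (floor_log v \<in> X))) = 0"
    unfolding sum_bucket_weight by simp
  have one: "(\<Sum>v\<in>?V. bucket_weight n v * 1) = 1"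
    unfolding sum_bucket_weight using assms(1) by simp
  have "?f v = bucket_weight n v * 1 + \<delta> * (bucket_weight n v * ((-1) ^ v * of_bool (floor_log v \<in> X)))" for v
    by (simp add: algebra_simps)
  then have "(\<Sum>v\<in>?V. ?f v) = 1"
    using zero one by (simp only: sum.distrib sum_distrib_left[symmetric] mult_zero_right add_0_right)
  moreover have "(\<integral>\<^sup>+v. ennreal (?f v) \<partial>count_space UNIV) = (\<Sum>v\<in>?V. ennreal (?f v))"
    by (intro nn_integral_count_space') (auto simp: bucket_weight_def)
  ultimately show "(\<integral>\<^sup>+v. ennreal (?f v) \<partial>count_space UNIV) = 1"
    using nonneg by (simp add: sum_ennreal)
qed

text \<open>The point \<open>u\<close> is arbitrary so that it can be the image of \<open>v\<close>
  under any relabelling. The value at \<open>v\<close> is compared with zero, with a value of the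
  same bucket, or with a value at least a factor 2 away before tilting.\<close>

lemma pmf_bucket_pmf_diff_ge:
  fixes \<delta> :: real
  assumes n: "0 < n" and \<delta>: "0 \<le> \<delta>" "\<delta> \<le> 1 / 5"
    and v: "v \<in> {2..<2 ^ (n + 1)}" and diff: "floor_log v \<in> X \<longleftrightarrow> floor_log v \<notin> Y"
  shows "\<delta> * bucket_weight n v \<le> \<bar>pmf (bucket_pmf n \<delta> X) v - pmf (bucket_pmf n \<delta> Y) u\<bar>"
proof -
  define x where "x = \<delta> * (-1) ^ v * of_bool (floor_log v \<in> X)"
  define y where "y = \<delta> * (-1) ^ u * of_bool (floor_log u \<in> Y)"
  define a where "a = bucket_weight n v"
  define b where "b = bucket_weight n u"
  have pX: "pmf (bucket_pmf n \<delta> X) v = a * (1 + x)" and pY: "pmf (bucket_pmf n \<delta> Y) u = b * (1 + y)"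
    using n \<delta> by (simp_all add: pmf_bucket_pmf a_def b_def x_def y_def)
  have x: "- \<delta> \<le> x" "x \<le> \<delta>" and y: "- \<delta> \<le> y" "y \<le> \<delta>"
    using \<delta> by (cases "even v"; cases "even u"; simp add: x_def y_def)+
  have a: "0 < a"
    using v n by (simp add: a_def bucket_weight_def)
  have "a * (1 - \<delta>) \<le> a * (1 + x)" "a * (1 + x) \<le> a * (1 + \<delta>)"
    using a x by (intro mult_left_mono; simp)+
  then have ax: "a - \<delta> * a \<le> a * (1 + x)" "a * (1 + x) \<le> a + \<delta> * a"
    by (simp_all only: distrib_left right_diff_distrib mult.commute[of a \<delta>] mult_1_right)
  have b0: "0 \<le> b"
    unfolding b_def by (rule bucket_weight_nonneg)
  have "b * (1 - \<delta>) \<le> b * (1 + y)" "b * (1 + y) \<le> b * (1 + \<delta>)"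
    using b0 y by (intro mult_left_mono; simp)+
  then have b_le: "b - \<delta> * b \<le> b * (1 + y)" "b * (1 + y) \<le> b + \<delta> * b"
    by (simp_all only: distrib_left right_diff_distrib mult.commute[of b \<delta>] mult_1_right)
  have a\<delta>: "\<delta> * a \<le> 1 / 5 * a" and b\<delta>: "\<delta> * b \<le> 1 / 5 * b"
    using a b0 \<delta> by (intro mult_right_mono; simp)+
  show ?thesis
  proof (cases "u \<in> {2..<2 ^ (n + 1)}")
    case False
    then have "b * (1 + y) = 0"
      by (auto simp: b_def bucket_weight_def)
    then show ?thesis
      unfolding pX pY a_def[symmetric] using ax a\<delta> a by linarith
  next
    case True
    have w: "a = 1 / (n * 2 ^ floor_log v)" "b = 1 / (n * 2 ^ floor_log u)"
      using v True by (simp_all add: a_def b_def bucket_weight_def)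
    have dbl: "2 * (1 / (n * 2 ^ j)) \<le> 1 / (n * 2 ^ i :: real)" if "i < j" for i j :: nat
    proof -
      have "(2::real) ^ Suc i \<le> 2 ^ j"
        using that by (intro power_increasing) auto
      then show ?thesis
        using n by (simp add: field_simps)
    qed
    consider (eq) "floor_log u = floor_log v" | (less) "floor_log u < floor_log v"
      | (gr) "floor_log v < floor_log u"
      by linarith
    then show ?thesis
    proof cases
      case eq
      then have "b = a"
        using w by simp
      then have "a * (1 + x) - b * (1 + y) = a * (x - y)"
        by (simp add: algebra_simps)
      \<comment> \<open>In a common bucket exactly one of the two distributions is tilted, so one of
        \<open>x\<close> and \<open>y\<close> is 0 and the other is \<delta> up to sign.\<close>
      moreover have "\<bar>x - y\<bar> = \<delta>"
        using eq diff \<delta> by (auto simp: x_def y_def abs_mult)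
      ultimately show ?thesis
        unfolding pX pY a_def[symmetric] using a by (simp add: abs_mult)
    next
      case less
      then have "2 * a \<le> b"
        using dbl w by simp
      then show ?thesis
        unfolding pX pY a_def[symmetric] using ax b_le a\<delta> b\<delta> a by linarith
    next
      \<comment> \<open>This case determines the bound 1/5: the gap is at least
        \<open>a * (1 - \<delta>) - a / 2 * (1 + \<delta>)\<close>, and this is at least
        \<open>\<delta> * a\<close> exactly when \<open>\<delta> \<le> 1 / 5\<close>.\<close>
      case gr
      then have "2 * b \<le> a"
        using dbl w by simp
      then show ?thesis
        unfolding pX pY a_def[symmetric] using ax b_le a\<delta> b\<delta> a by linarith
    qed
  qed
qed

text \<open>
  No relabelling helps, since the values taken by one distribution on a bucket where the codes differ
  are far from all values of the other distribution.
\<close>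

lemma d_TV_bucket_pmf_ge:
  fixes \<delta> :: real
  assumes n: "0 < n" and \<delta>: "0 \<le> \<delta>" "\<delta> \<le> 1 / 5"
    and \<pi>: "\<pi> permutes \<Omega>" and \<Omega>: "finite \<Omega>" "{2..<2 ^ (n + 1)} \<subseteq> \<Omega>"
    and XY: "X \<subseteq> {1..n}" "Y \<subseteq> {1..n}"
  shows "\<delta> * card (sym_diff X Y) / (2 * n)
    \<le> d_TV \<Omega> (bucket_pmf n \<delta> X) (map_pmf (inv \<pi>) (bucket_pmf n \<delta> Y))"
proof -
  let ?V = "{2..<2 ^ (n + 1)} :: nat set"
  let ?D = "sym_diff X Y"
  let ?\<mu> = "bucket_pmf n \<delta>"
  have relabel: "pmf (map_pmf (inv \<pi>) (?\<mu> Y)) v = pmf (?\<mu> Y) (\<pi> v)" for v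
    using pmf_map_inj'[of "inv \<pi>" "?\<mu> Y" "\<pi> v"] permutes_inj[OF permutes_inv[OF \<pi>]]
      permutes_inverses(2)[OF \<pi>] by simp
  have "\<delta> * card ?D / n = \<delta> * (\<Sum>v\<in>?V. bucket_weight n v * of_bool (floor_log v \<in> ?D))"
    using XY by (subst sum_bucket_weight_indicator[OF n]) auto
  also have "\<dots> = (\<Sum>v\<in>?V. \<delta> * bucket_weight n v * of_bool (floor_log v \<in> ?D))"
    by (simp add: sum_distrib_left mult.assoc)
  also have "\<dots> \<le> (\<Sum>v\<in>?V. \<bar>pmf (?\<mu> X) v - pmf (?\<mu> Y) (\<pi> v)\<bar>)"
  proof (rule sum_mono)
    fix v assume "v \<in> ?V"
    then show "\<delta> * bucket_weight n v * of_bool (floor_log v \<in> ?D) \<le> \<bar>pmf (?\<mu> X) v - pmf (?\<mu> Y) (\<pi> v)\<bar>"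
      using pmf_bucket_pmf_diff_ge[OF n \<delta>, of v X Y "\<pi> v"] by (cases "floor_log v \<in> ?D") auto
  qed
  also have "\<dots> \<le> (\<Sum>v\<in>\<Omega>. \<bar>pmf (?\<mu> X) v - pmf (?\<mu> Y) (\<pi> v)\<bar>)"
    using \<Omega> by (intro sum_mono2) auto
  finally show ?thesis
    by (simp add: d_TV_def relabel)
qed

subsection \<open>The lower bound\<close>

text \<open>A randomized test is a mixture of deterministic strategies and averages are linear in
  it, so a bound for every strategy in the support passes to the test.\<close>

lemma outcome_average_diff_le:
  assumes "finite A" "finite B"
    and le: "\<And>t. t \<in> set_pmf T \<Longrightarrow>
      (\<Sum>x\<in>A. pmf (verdict (\<mu> x) t) a) / \<alpha> - (\<Sum>y\<in>B. pmf (verdict (\<nu> y) t) a) / \<beta> \<le> e"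
  shows "(\<Sum>x\<in>A. pmf (outcome (\<mu> x) T) a) / \<alpha> - (\<Sum>y\<in>B. pmf (outcome (\<nu> y) T) a) / \<beta> \<le> e"
proof -
  have int: "integrable (measure_pmf T) (\<lambda>t. pmf (verdict \<rho> t) a)" for \<rho>
    by (intro measure_pmf.integrable_const_bound[where B = 1]) (auto simp: pmf_le_1)
  have "(\<Sum>x\<in>A. pmf (outcome (\<mu> x) T) a) / \<alpha> - (\<Sum>y\<in>B. pmf (outcome (\<nu> y) T) a) / \<beta>
      = (\<integral>t. (\<Sum>x\<in>A. pmf (verdict (\<mu> x) t) a) / \<alpha> - (\<Sum>y\<in>B. pmf (verdict (\<nu> y) t) a) / \<beta> \<partial>measure_pmf T)"
    using int by (simp add: outcome_def pmf_bind)
  also have "\<dots> \<le> e"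
    using int le by (intro measure_pmf.integral_le_const) (auto simp: AE_measure_pmf_iff)
  finally show ?thesis .
qed

text \<open>It turns the norm growth over \<open>q\<close> draws into an exponent linear in
  \<open>q\<close>.\<close>

lemma one_plus_div_one_minus_le_exp:
  fixes y :: real
  assumes "0 \<le> y" "y \<le> 1 / 3"
  shows "(1 + y) / (1 - y) \<le> exp (3 * y)"
proof -
  have "y * y \<le> y * (1 / 3)"
    using assms by (intro mult_left_mono) auto
  then have "1 + y \<le> (1 + 3 * y) * (1 - y)"
    by (simp add: algebra_simps)
  then have "(1 + y) / (1 - y) \<le> 1 + 3 * y"
    using assms by (simp add: pos_divide_le_eq)
  also have "\<dots> \<le> exp (3 * y)"
    by (rule exp_ge_add_one_self)
  finally show ?thesis .
qed

section \<open>Orbits under relabelling as properties\<close>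

lemma label_invariant_orbit:
  "label_invariant \<Omega> {map_pmf (inv \<pi>) \<mu> | \<pi> \<mu>. \<pi> permutes \<Omega> \<and> \<mu> \<in> M}"
  unfolding label_invariant_def
proof (intro ballI allI impI)
  fix \<nu> \<rho> assume "\<nu> \<in> {map_pmf (inv \<pi>) \<mu> | \<pi> \<mu>. \<pi> permutes \<Omega> \<and> \<mu> \<in> M}" and \<rho>: "\<rho> permutes \<Omega>"
  then obtain \<pi> \<mu> where \<pi>: "\<pi> permutes \<Omega>" and \<mu>: "\<mu> \<in> M" and \<nu>: "\<nu> = map_pmf (inv \<pi>) \<mu>"
    by blast
  have "map_pmf (inv \<rho>) \<nu> = map_pmf (inv (\<pi> \<circ> \<rho>)) \<mu>"
    using \<pi> \<rho> by (simp add: \<nu> pmf.map_comp o_inv_distrib permutes_bij)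
  moreover have "(\<pi> \<circ> \<rho>) permutes \<Omega>"
    by (rule permutes_compose[OF \<rho> \<pi>])
  ultimately show "map_pmf (inv \<rho>) \<nu> \<in> {map_pmf (inv \<pi>) \<mu> | \<pi> \<mu>. \<pi> permutes \<Omega> \<and> \<mu> \<in> M}"
    using \<mu> by blast
qed

text \<open>Finitely many distributions have finitely many relabellings, and finite sets are
  closed.\<close>

lemma dist_property_orbit:
  fixes \<Omega> :: "'a::countable set"
  assumes "finite \<Omega>" "finite M" "M \<subseteq> dists \<Omega>"
  shows "dist_property \<Omega> {map_pmf (inv \<pi>) \<mu> | \<pi> \<mu>. \<pi> permutes \<Omega> \<and> \<mu> \<in> M}" (is "dist_property _ ?P")
proof -
  have "?P = (\<lambda>(\<pi>, \<mu>). map_pmf (inv \<pi>) \<mu>) ` ({\<pi>. \<pi> permutes \<Omega>} \<times> M)"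
    by auto
  then have "finite ?P"
    using assms by (simp add: finite_permutations)
  then have "closed (pmf ` ?P)"
    by (intro finite_imp_closed finite_imageI)
  moreover have "?P \<subseteq> dists \<Omega>"
  proof
    fix \<nu> assume "\<nu> \<in> ?P"
    then obtain \<pi> \<mu> where \<pi>: "\<pi> permutes \<Omega>" and \<mu>: "\<mu> \<in> M" and \<nu>: "\<nu> = map_pmf (inv \<pi>) \<mu>"
      by blast
    have "set_pmf \<mu> \<subseteq> \<Omega>"
      using \<mu> assms(3) by (auto simp: dists_def)
    then show "\<nu> \<in> dists \<Omega>"
      using permutes_image[OF permutes_inv[OF \<pi>]] by (auto simp: \<nu> dists_def)
  qed
  ultimately show ?thesis
    by (simp add: dist_property_def)
qed

text \<open>The parameters are \<open>32 * r\<close> buckets, \<open>16 * r\<close> generators,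
  independence degree \<open>r\<close> and norm weight 4. A test with few draws would accept random
  codewords and random sets with nearly equal probability, although most sets are far from the
  code.\<close>

lemma hard_property_exists:
  fixes \<epsilon> :: real and r :: nat and \<Omega> :: "nat set"
  assumes \<epsilon>: "0 < \<epsilon>" "\<epsilon> < 1 / 768" and r: "0 < r"
    and \<Omega>: "finite \<Omega>" "{2..<2 ^ (32 * r + 1)} \<subseteq> \<Omega>"
  shows "\<exists>P. dist_property \<Omega> P \<and> label_invariant \<Omega> P \<and>
    (\<forall>T q. is_test \<Omega> \<epsilon> P T \<and> sample_bound T q \<longrightarrow> r < 768 * \<epsilon> * q)"
proof -
  define n where "n = 32 * r"
  \<comment> \<open>With this choice more than \<open>r\<close> differing buckets give a distance
    above \<open>64 * \<epsilon> * r / (2 * 32 * r) = \<epsilon>\<close>. The bound on \<epsilon>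
    gives \<open>4 * \<delta> < 1 / 3\<close>, as the exponential estimate requires.\<close>
  define \<delta> where "\<delta> = 64 * \<epsilon>"
  let ?I = "{1..n}" and ?J = "{..<16 * r}"
  let ?\<mu> = "bucket_pmf n \<delta>"
  have n: "0 < n" and \<delta>: "0 \<le> \<delta>" "\<delta> \<le> 1 / 5" "\<delta> \<le> 1"
    using r \<epsilon> by (simp_all add: n_def \<delta>_def)
  have cards: "card ?I = 32 * r" "card ?J = 16 * r"
    by (simp_all add: n_def)
  have "card {S \<in> Pow ?I. card S \<le> r} \<le> 2 ^ (8 * r)"
    using cards by (intro card_small_subsets) auto
  also have "(2::nat) ^ (8 * r) < 2 ^ card ?J"
    using r by (intro power_strict_increasing) auto
  finally obtain C :: "nat set \<Rightarrow> nat set" where C: "\<And>U. C U \<subseteq> ?I"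
    and C_indep: "\<And>S. S \<subseteq> ?I \<Longrightarrow> S \<noteq> {} \<Longrightarrow> card S \<le> r \<Longrightarrow> (\<Sum>U\<in>Pow ?J. chi S (C U)) = 0"
    using independent_code[of ?I ?J r] by (metis finite_atLeastAtMost finite_lessThan)
  define M where "M = ?\<mu> ` C ` Pow ?J"
  define P where "P = {map_pmf (inv \<pi>) \<mu> | \<pi> \<mu>. \<pi> permutes \<Omega> \<and> \<mu> \<in> M}"
  have dists: "?\<mu> X \<in> dists \<Omega>" for X
    using \<Omega>(2) n \<delta> by (auto simp: dists_def set_pmf_iff pmf_bucket_pmf bucket_weight_def n_def split: if_splits)
  have "dist_property \<Omega> P"
    unfolding P_def using dists by (intro dist_property_orbit \<Omega>(1)) (auto simp: M_def)
  moreover have "label_invariant \<Omega> P"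
    unfolding P_def by (rule label_invariant_orbit)
  moreover have "r < 768 * \<epsilon> * q" if T: "is_test \<Omega> \<epsilon> P T" "sample_bound T q" for T q
  proof (rule ccontr)
    assume "\<not> r < 768 * \<epsilon> * q"
    then have q: "q * (3 * (4 * \<delta>)) \<le> r"
      by (simp add: \<delta>_def mult_ac)
    define F where "F X = pmf (outcome (?\<mu> X) T) True" for X
    have F1: "F X \<le> 1" for X
      by (simp add: F_def pmf_le_1)
    have yes: "2 / 3 \<le> F (C U)" if "U \<in> Pow ?J" for U
    proof -
      have "map_pmf (inv id) (?\<mu> (C U)) \<in> P"
        using that permutes_id[of \<Omega>] unfolding P_def M_def by blast
      then show ?thesis
        using T(1) by (simp add: is_test_def F_def)
    qed
    have no: "F X \<le> 1 / 3" if X: "X \<subseteq> ?I" "\<forall>U\<in>Pow ?J. r < card (sym_diff X (C U))" for X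
    proof -
      have "\<epsilon> < d_TV \<Omega> (?\<mu> X) \<nu>" if "\<nu> \<in> P" for \<nu>
      proof -
        obtain \<pi> U where \<pi>: "\<pi> permutes \<Omega>" and U: "U \<in> Pow ?J" and \<nu>: "\<nu> = map_pmf (inv \<pi>) (?\<mu> (C U))"
          using \<open>\<nu> \<in> P\<close> by (auto simp: P_def M_def)
        have "\<epsilon> * (2 * n) < \<delta> * card (sym_diff X (C U))"
          using X(2) U \<epsilon>(1) by (simp add: \<delta>_def n_def)
        then have "\<epsilon> < \<delta> * card (sym_diff X (C U)) / (2 * n)"
          using n by (simp add: field_simps)
        also have "\<dots> \<le> d_TV \<Omega> (?\<mu> X) \<nu>"
          unfolding \<nu> using n \<delta> \<pi> \<Omega> X(1) C by (intro d_TV_bucket_pmf_ge) (simp_all add: n_def)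
        finally show ?thesis .
      qed
      then have "2 / 3 \<le> pmf (outcome (?\<mu> X) T) False"
        using T(1) dists by (simp add: is_test_def)
      then show ?thesis
        by (simp add: F_def pmf_False_conv_True)
    qed
    \<comment> \<open>The assumed bound on \<open>q\<close> keeps the norm below
      \<open>exp 1 ^ r\<close>, hence below \<open>4 ^ r\<close>, whereas degrees above
      \<open>r\<close> are damped by \<open>4 ^ (r + 1)\<close>.\<close>
    have "(\<Sum>U\<in>Pow ?J. F (C U)) / real (card (Pow ?J)) - (\<Sum>X\<in>Pow ?I. F X) / 2 ^ card ?I \<le> 1 / 4"
      unfolding F_def
    proof (rule outcome_average_diff_le)
      fix t assume t: "t \<in> set_pmf T"
      let ?f = "\<lambda>X. pmf (verdict (?\<mu> X) t) True"
      let ?B = "(1 + 4 * \<delta>) / (1 - 4 * \<delta>)"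
      have t_q: "queries_within \<Omega> t" "draws_at_most t q"
        using t T by (auto simp: is_test_def sample_bound_def)
      have "wnorm ?I 4 ?f \<le> ?B ^ q"
      proof (rule wnorm_verdict_le[OF _ \<Omega>(1) _ _ _ _ \<delta>(1) _ _ t_q])
        show "pmf (?\<mu> X) v = bucket_weight n v * (1 + \<delta> * (-1) ^ v * of_bool (floor_log v \<in> X))" for X v
          by (rule pmf_bucket_pmf[OF n \<delta>(1,3)])
        show "floor_log v \<in> ?I" if "bucket_weight n v \<noteq> 0" for v
          using that by (intro floor_log_in_range) (auto simp: bucket_weight_def split: if_splits)
      qed (use \<epsilon> in \<open>auto simp: \<delta>_def bucket_weight_nonneg power_abs\<close>)
      also have "?B ^ q \<le> exp (3 * (4 * \<delta>)) ^ q"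
        using \<epsilon> by (intro power_mono one_plus_div_one_minus_le_exp) (auto simp: \<delta>_def)
      also have "\<dots> \<le> exp (real r * 1)"
        using q by (simp flip: exp_of_nat_mult)
      also have "\<dots> = exp 1 ^ r"
        by (rule exp_of_nat_mult)
      also have "\<dots> \<le> 4 ^ r"
        using exp_le by (intro power_mono) auto
      finally have "wnorm ?I 4 ?f / 4 ^ (r + 1) \<le> 1 / 4"
        by (simp add: field_simps)
      moreover have "\<bar>(\<Sum>U\<in>Pow ?J. ?f (C U)) / card (Pow ?J) - (\<Sum>X\<in>Pow ?I. ?f X) / 2 ^ card ?I\<bar>
          \<le> wnorm ?I 4 ?f / 4 ^ (r + 1)"
        using C C_indep by (intro average_diff_le_wnorm) auto
      ultimately show "(\<Sum>U\<in>Pow ?J. ?f (C U)) / real (card (Pow ?J)) - (\<Sum>X\<in>Pow ?I. ?f X) / 2 ^ card ?I \<le> 1 / 4"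
        by linarith
    qed auto
    moreover have "2 / 3 \<le> (\<Sum>U\<in>Pow ?J. F (C U)) / card (Pow ?J)"
    proof -
      have "real (card (Pow ?J)) * (2 / 3) \<le> (\<Sum>U\<in>Pow ?J. F (C U))"
        using yes by (intro sum_bounded_below) auto
      moreover have "0 < real (card (Pow ?J))"
        by (simp add: card_Pow)
      ultimately show ?thesis
        by (simp add: pos_le_divide_eq mult.commute)
    qed
    \<comment> \<open>Sets far from the code are accepted with probability at most 1/3. The others
      form a fraction of at most 2 to the power \<open>-8 * r\<close>, hence at most 1/256.\<close>
    moreover have "(\<Sum>X\<in>Pow ?I. F X) / 2 ^ card ?I \<le> 1 / 3 + 1 / 256"
    proof -
      let ?near = "{X \<in> Pow ?I. \<exists>U\<in>Pow ?J. card (sym_diff X (C U)) \<le> r}"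
      have "(\<Sum>X\<in>Pow ?I. F X) \<le> (\<Sum>X\<in>Pow ?I. 1 / 3 + of_bool (X \<in> ?near))"
      proof (rule sum_mono)
        fix X assume X: "X \<in> Pow ?I"
        show "F X \<le> 1 / 3 + of_bool (X \<in> ?near)"
        proof (cases "X \<in> ?near")
          case True
          then show ?thesis
            using F1[of X] by simp
        next
          case False
          then have "F X \<le> 1 / 3"
            using X by (intro no) (auto simp: not_le)
          with False show ?thesis
            by simp
        qed
      qed
      also have "\<dots> = 2 ^ (32 * r) * (1 / 3) + card ?near"
      proof -
        have "Pow ?I \<inter> {X. X \<in> ?near} = ?near"
          by auto
        then show ?thesis
          by (simp add: sum.distrib of_bool_def sum.If_cases card_Pow n_def del: Int_Collect mem_Collect_eq)
      qed
      also have "real (card ?near) \<le> 2 ^ (24 * r)"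
        using of_nat_mono[where 'a = real, OF card_near_code[of ?I r ?J C]] cards C by simp
      also have "(2::real) ^ (24 * r) \<le> 2 ^ (32 * r) * (1 / 256)"
      proof -
        have "(2::real) ^ (24 * r + 8) \<le> 2 ^ (32 * r)"
          using r by (intro power_increasing) auto
        then show ?thesis
          by (simp add: power_add)
      qed
      finally show ?thesis
        unfolding cards by (simp add: field_simps)
    qed
    \<comment> \<open>The averages differ by at least \<open>1 / 3 - 1 / 256\<close>, which exceeds
      1/4.\<close>
    ultimately show False
      by linarith
  qed
  ultimately show ?thesis
    by blast
qed

theorem theorem10p51:
  "\<exists>c::real. c > 0 \<and> (\<exists>\<epsilon>\<^sub>0::real. \<epsilon>\<^sub>0 > 0 \<and> (\<exists>N\<^sub>0::nat.
     \<forall>(\<epsilon>::real) (N::nat). 0 < \<epsilon> \<and> \<epsilon> < \<epsilon>\<^sub>0 \<and> N\<^sub>0 \<le> N \<longrightarrow>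
       (\<exists>P :: nat pmf set.
          dist_property {1..N} P \<and> label_invariant {1..N} P \<and>
          (\<forall>T q. is_test {1..N} \<epsilon> P T \<and> sample_bound T q \<longrightarrow>
             real q \<ge> c * (ln (real N) / \<epsilon>)))))"
proof (rule exI[of _ "1 / (128 * 768)"], rule conjI, simp, rule exI[of _ "1 / 768"], rule conjI, simp,
    rule exI[of _ "3 ^ 64"], intro allI impI)
  fix \<epsilon> :: real and N :: nat
  assume "0 < \<epsilon> \<and> \<epsilon> < 1 / 768 \<and> 3 ^ 64 \<le> N"
  then have \<epsilon>: "0 < \<epsilon>" "\<epsilon> < 1 / 768" and N: "3 ^ 64 \<le> N"
    by blast+
  \<comment> \<open>The threshold \<open>3 ^ 64\<close> ensures \<open>ln N \<ge> 64\<close>, which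
    makes the \<open>r\<close> below positive.\<close>
  have "exp 1 ^ 64 \<le> (3::real) ^ 64"
    using exp_le by (intro power_mono) auto
  also have "\<dots> \<le> N"
    using N by (metis of_nat_le_iff of_nat_numeral of_nat_power)
  finally have "exp 64 \<le> real N"
    by (simp flip: exp_of_nat_mult)
  then have ln64: "64 \<le> ln N"
    using N by (subst ln_ge_iff) auto
  \<comment> \<open>Rounding down costs at most a factor 2 because \<open>r \<ge> 1\<close>; this is
    why 128 replaces 64 in the final constant.\<close>
  define r where "r = nat \<lfloor>ln N / 64\<rfloor>"
  have "real r \<le> ln N / 64" "ln N / 64 < real r + 1"
    using ln64 unfolding r_def by linarith+
  moreover have "1 \<le> real r"
    using ln64 by (simp add: r_def le_nat_iff le_floor_iff)
  ultimately have r: "0 < r" "64 * real r \<le> ln N" "ln N / 128 \<le> r"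
    by linarith+
  \<comment> \<open>All \<open>32 * r\<close> buckets have to fit into
    \<open>{1..N}\<close>.\<close>
  have "(2::real) ^ (32 * r + 1) \<le> 2 ^ (64 * r)"
    using r(1) by (intro power_increasing) auto
  also have "\<dots> \<le> exp 1 ^ (64 * r)"
    using exp_ge_add_one_self[of 1] by (intro power_mono) auto
  also have "\<dots> = exp (64 * real r)"
    by (simp flip: exp_of_nat_mult)
  also have "\<dots> \<le> N"
    using r(2) N by (subst ln_ge_iff[symmetric]) auto
  finally have "2 ^ (32 * r + 1) \<le> N"
    by (metis of_nat_le_iff of_nat_numeral of_nat_power)
  then have "{2..<2 ^ (32 * r + 1)} \<subseteq> {1..N}"
    by auto
  then obtain P where P: "dist_property {1..N} P" "label_invariant {1..N} P"
    and hard: "\<And>T q. is_test {1..N} \<epsilon> P T \<Longrightarrow> sample_bound T q \<Longrightarrow> r < 768 * \<epsilon> * q"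
    using hard_property_exists[OF \<epsilon> r(1), of "{1..N}"] by auto
  have "1 / (128 * 768) * (ln N / \<epsilon>) \<le> q" if "is_test {1..N} \<epsilon> P T" "sample_bound T q" for T q
  proof -
    have "ln N / 128 \<le> 768 * \<epsilon> * q"
      using hard[OF that] r(3) by linarith
    then show ?thesis
      using \<epsilon>(1) by (simp add: field_simps)
  qed
  with P show "\<exists>P. dist_property {1..N} P \<and> label_invariant {1..N} P \<and>
      (\<forall>T q. is_test {1..N} \<epsilon> P T \<and> sample_bound T q \<longrightarrow>
        1 / (128 * 768) * (ln (real N) / \<epsilon>) \<le> real q)"
    by blast
qed

end
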